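(* For every $\delta>0$ there exists $n_0=n_0(\delta)=144/\delta^2$ such that the following holds for every integer $n\geq n_0$. Let $G$ be a multigraph whose edges are coloured with $n$ colours, such that for each colour $c$, the subgraph formed by the edges of colour $c$ (on the vertices incident to them) has at least $(3+\delta)n$ vertices and is a disjoint union of nontrivial cliques. Then $G$ contains a rainbow matching of size $n$.
   Context: A nontrivial clique is a complete graph on at least $2$ vertices. A matching in an edge-coloured multigraph is a set of pairwise vertex-disjoint edges; it is a rainbow matching if all its edges have distinct colours. *)

theory Defs
  imports Complex_Main "HOL-Library.Disjoint_Sets"
begin

text \<open>
  Edges have an identity of their own (type \<^typ>\<open>'e\<close>), so that several edges may have the same
  pair of endpoints.
\<close>

record ('v, 'e) multigraph =
  verts :: "'v set"
  edges :: "'e set"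
  ends :: "'e \<Rightarrow> 'v set"

text \<open>Multigraphs are finite and loopless.\<close>

definition is_multigraph :: "('v, 'e) multigraph \<Rightarrow> bool" where
  "is_multigraph G \<longleftrightarrow> finite (verts G) \<and> finite (edges G) \<and>
     (\<forall>e\<in>edges G. ends G e \<subseteq> verts G \<and> card (ends G e) = 2)"

definition induced :: "('v, 'e) multigraph \<Rightarrow> 'v set \<Rightarrow> ('v, 'e) multigraph" where
  "induced G A = \<lparr>verts = A, edges = {e \<in> edges G. ends G e \<subseteq> A}, ends = ends G\<rparr>"

text \<open>A complete graph is simple, hence \<open>\<exists>!\<close>: it has no parallel edges.\<close>

definition complete_graph :: "('v, 'e) multigraph \<Rightarrow> bool" where
  "complete_graph G \<longleftrightarrow> is_multigraph G \<and>
     (\<forall>u\<in>verts G. \<forall>v\<in>verts G. u \<noteq> v \<longrightarrow> (\<exists>!e. e \<in> edges G \<and> ends G e = {u, v}))"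

definition nontrivial_clique :: "('v, 'e) multigraph \<Rightarrow> bool" where
  "nontrivial_clique G \<longleftrightarrow> complete_graph G \<and> card (verts G) \<ge> 2"

definition disjoint_union_of_nontrivial_cliques :: "('v, 'e) multigraph \<Rightarrow> bool" where
  "disjoint_union_of_nontrivial_cliques G \<longleftrightarrow>
     (\<exists>P. partition_on (verts G) P \<and>
          (\<forall>A\<in>P. nontrivial_clique (induced G A)) \<and>
          (\<forall>e\<in>edges G. \<exists>A\<in>P. ends G e \<subseteq> A))"

definition edge_colouring :: "('v, 'e) multigraph \<Rightarrow> ('e \<Rightarrow> 'c) \<Rightarrow> 'c set \<Rightarrow> bool" where
  "edge_colouring G col C \<longleftrightarrow> finite C \<and> (\<forall>e\<in>edges G. col e \<in> C)"

definition colour_subgraph :: "('v, 'e) multigraph \<Rightarrow> ('e \<Rightarrow> 'c) \<Rightarrow> 'c \<Rightarrow> ('v, 'e) multigraph" where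
  "colour_subgraph G col c =
     \<lparr>verts = (\<Union>e\<in>{e \<in> edges G. col e = c}. ends G e),
      edges = {e \<in> edges G. col e = c},
      ends = ends G\<rparr>"

definition matching :: "('v, 'e) multigraph \<Rightarrow> 'e set \<Rightarrow> bool" where
  "matching G M \<longleftrightarrow> M \<subseteq> edges G \<and>
     (\<forall>e\<in>M. \<forall>f\<in>M. e \<noteq> f \<longrightarrow> ends G e \<inter> ends G f = {})"

definition rainbow_matching :: "('v, 'e) multigraph \<Rightarrow> ('e \<Rightarrow> 'c) \<Rightarrow> 'e set \<Rightarrow> bool" where
  "rainbow_matching G col M \<longleftrightarrow> matching G M \<and> inj_on col M"

end

theory Submission
  imports Defs
begin

text \<open>
  Adding one colour at a time, suppose a rainbow matching \<open>f\<close>, with vertex set \<open>X\<close>, misses only the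
  colour \<open>c0\<close> and cannot be completed. If colour \<open>c\<close> has edges from both ends of the matching edge
  \<open>f d\<close> to distinct vertices outside \<open>X\<close>, then exchanging \<open>f d\<close> for one of them moves the missing
  colour from \<open>c\<close> to \<open>d\<close>. Each exchange can be made in two ways, so along a chain of exchanges using
  pairwise disjoint outside pairs any single outside vertex can be avoided. Consequently the colour
  \<open>c\<close> missing at the end of a short chain has many edges matching vertices of \<open>X\<close> to vertices
  outside, otherwise the matching could be completed.

  With \<open>K = \<lfloor>sqrt n\<rfloor>\<close>, some level \<open>k < K\<close> of the breadth-first search along exchanges gains at most
  \<open>K + 1\<close> colours. Let \<open>D\<close> be the colours reached at that level. A colour outside the next level
  receives at most one edge of each \<open>c \<in> D\<close>, so \<open>c\<close> sends at least \<open>|D| + 7 K + 5\<close> edges into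
  the matching edges coloured by \<open>D\<close>. By averaging, some \<open>d \<in> D\<close> has at least \<open>7 K + 5\<close> colours \<open>c\<close>
  that meet both ends of \<open>f d\<close> while \<open>d\<close> meets \<open>f c\<close>. Two such colours \<open>b, c\<close> in general position
  complete the matching: reach \<open>b\<close>, then place \<open>b\<close> at one end of \<open>f d\<close>, \<open>c\<close> at the other end, and
  \<open>d\<close> at the freed edge \<open>f c\<close>.
\<close>

section \<open>Rainbow matchings as families indexed by colours\<close>

text \<open>An edge is represented by its set of end points and indexed by its colour, so colours
  are distinct automatically and parallel edges are identified.\<close>

definition rainbow :: "('c \<Rightarrow> 'v set set) \<Rightarrow> 'c set \<Rightarrow> ('c \<Rightarrow> 'v set) \<Rightarrow> bool" where
  "rainbow E C f \<longleftrightarrow> (\<forall>c\<in>C. f c \<in> E c) \<and> disjoint_family_on f C"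

lemma rainbow_subset: "rainbow E C f \<Longrightarrow> B \<subseteq> C \<Longrightarrow> rainbow E B f"
  unfolding rainbow_def by (meson disjoint_family_on_mono subsetD)

lemma rainbow_edge: "rainbow E C f \<Longrightarrow> c \<in> C \<Longrightarrow> f c \<in> E c"
  unfolding rainbow_def by blast

lemma rainbow_disjoint:
  "rainbow E C f \<Longrightarrow> b \<in> C \<Longrightarrow> c \<in> C \<Longrightarrow> b \<noteq> c \<Longrightarrow> f b \<inter> f c = {}"
  unfolding rainbow_def disjoint_family_on_def by blast

lemma rainbow_update:
  assumes "rainbow E (C - {c}) f" "e \<in> E c" "\<And>b. b \<in> C - {c} \<Longrightarrow> f b \<inter> e = {}"
  shows "rainbow E C (f(c := e))"
  using assms unfolding rainbow_def disjoint_family_on_def by (auto; blast)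

text \<open>\<open>edge_trans\<close> is all that the cliques contribute: adjacency in one colour is
  transitive.\<close>

locale clique_colouring =
  fixes E :: "'c \<Rightarrow> 'v set set"
  assumes card_edge: "e \<in> E c \<Longrightarrow> card e = 2"
    and edge_trans: "{u, v} \<in> E c \<Longrightarrow> {v, w} \<in> E c \<Longrightarrow> u \<noteq> w \<Longrightarrow> {u, w} \<in> E c"

text \<open>The situation refuted by \<open>contradiction\<close>. The bound \<open>K\<close>
  amounts to \<open>card C < (K + 1)^2\<close>.\<close>

locale blocked = clique_colouring E for E :: "'c \<Rightarrow> 'v set set" +
  fixes C :: "'c set" and c0 :: 'c and f :: "'c \<Rightarrow> 'v set" and K :: nat
  assumes finite_C: "finite C" and c0: "c0 \<in> C"
    and f: "rainbow E (C - {c0}) f"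
    and no_full: "\<not> rainbow E C g"
    and K: "card C \<le> K * K + 2 * K"
    and large: "c \<in> C \<Longrightarrow> 3 * card C + 12 * K \<le> card (\<Union>(E c))"
begin

section \<open>Exchanges that move the missing colour\<close>

definition X :: "'v set" where "X = \<Union>(f ` (C - {c0}))"

lemma card_f: "d \<in> C - {c0} \<Longrightarrow> card (f d) = 2"
  using f card_edge rainbow_edge by metis

lemma finite_f: "d \<in> C - {c0} \<Longrightarrow> finite (f d)"
  using card_f card.infinite by fastforce

lemma card_X: "card X \<le> 2 * (card C - 1)"
proof -
  have "card X \<le> (\<Sum>d\<in>C - {c0}. card (f d))"
    unfolding X_def using finite_C by (intro card_UN_le) auto
  also have "\<dots> = 2 * (card C - 1)"
    using card_f c0 finite_C by simp
  finally show ?thesis .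
qed

lemma finite_X: "finite X"
  unfolding X_def using finite_C finite_f by blast

text \<open>
  \<open>P\<close> collects the colours and \<open>Q\<close> the outside vertices touched by the exchanges leading to \<open>c\<close>; the
  quantified \<open>p\<close> is the outside vertex to be avoided.
\<close>

definition reach :: "'c set \<Rightarrow> 'v set \<Rightarrow> 'c \<Rightarrow> bool" where
  "reach P Q c \<longleftrightarrow> P \<subseteq> C \<and> c0 \<in> P \<and> c \<in> P \<and> finite Q \<and> Q \<inter> X = {} \<and>
     (\<forall>p. \<exists>g. rainbow E (C - {c}) g \<and> (\<forall>d\<in>C - P. g d = f d) \<and>
              \<Union>(g ` (C - {c})) \<subseteq> X \<union> (Q - {p}))"

lemma reachE:
  assumes "reach P Q c"
  obtains g where "rainbow E (C - {c}) g" "\<And>d. d \<in> C - P \<Longrightarrow> g d = f d"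
    "\<And>d. d \<in> C \<Longrightarrow> d \<noteq> c \<Longrightarrow> g d \<subseteq> X \<union> (Q - {p})"
proof -
  obtain g where "rainbow E (C - {c}) g" "\<forall>d\<in>C - P. g d = f d"
    "\<Union>(g ` (C - {c})) \<subseteq> X \<union> (Q - {p})"
    using assms unfolding reach_def by meson
  then show thesis by (intro that[of g]) auto
qed

lemma reach_c0: "reach {c0} {} c0"
  unfolding reach_def X_def using c0 f by auto

text \<open>The missing colour \<open>c\<close> would fit on \<open>{u, w}\<close>. Since
  \<open>u\<close> may lie in \<open>Q\<close>, it is the vertex to be avoided.\<close>

lemma reach_no_edge:
  assumes r: "reach P Q c" and e: "{u, w} \<in> E c" and w: "w \<notin> X \<union> Q" and u: "u \<notin> X"
  shows False
proof -
  obtain g where g: "rainbow E (C - {c}) g"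
    "\<And>d. d \<in> C \<Longrightarrow> d \<noteq> c \<Longrightarrow> g d \<subseteq> X \<union> (Q - {u})"
    using reachE[OF r, where p = u] by metis
  have "rainbow E C (g(c := {u, w}))"
    using g(1) e by (rule rainbow_update) (use g(2) w u in blast)
  then show False using no_full by blast
qed

text \<open>By \<open>reach_no_edge\<close>, vertices of colour \<open>c\<close> outside
  \<open>X \<union> Q\<close> have all their \<open>c\<close>-neighbours in \<open>X\<close>. Two of
  them with a common neighbour would be adjacent by \<open>edge_trans\<close>, so picking neighbours
  is injective.\<close>

lemma reach_neighbours:
  assumes r: "reach P Q c" and Q: "card Q \<le> 2 * k" and k: "k < K" and c: "c \<in> C"
  obtains S h where "S \<subseteq> X" "inj_on h S" "\<forall>x\<in>S. {x, h x} \<in> E c \<and> h x \<notin> X \<union> Q"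
    "card C + 10 * K + 4 \<le> card S"
proof -
  define V where "V = \<Union>(E c) - X - Q"
  have fin: "finite Q" using r unfolding reach_def by blast
  have "\<exists>u. {u, w} \<in> E c" if "w \<in> V" for w
  proof -
    have "w \<in> \<Union>(E c)" using that unfolding V_def by blast
    then obtain e where "e \<in> E c" "w \<in> e" by (rule UnionE)
    then show ?thesis using card_edge card_2_iff
      by (metis insertE insert_commute singletonD)
  qed
  then obtain h where h: "\<And>w. w \<in> V \<Longrightarrow> {h w, w} \<in> E c" by metis
  have hX: "h w \<in> X" if "w \<in> V" for w
    using reach_no_edge[OF r h[OF that]] that unfolding V_def by blast
  have inj: "inj_on h V"
  proof (rule inj_onI, rule ccontr)
    fix u w assume *: "u \<in> V" "w \<in> V" "h u = h w" "u \<noteq> w"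
    have "{u, h w} \<in> E c" using h[OF *(1)] *(3) by (simp add: insert_commute)
    then have "{u, w} \<in> E c" using edge_trans h[OF *(2)] *(4) by blast
    then show False using reach_no_edge[OF r] * unfolding V_def by blast
  qed
  have C1: "1 \<le> card C"
    using c0 finite_C by (metis One_nat_def Suc_leI card_gt_0_iff empty_iff)
  have "card (\<Union>(E c)) \<le> card V + card X + card Q"
  proof -
    have "finite (\<Union>(E c))"
      using large[OF c] C1 card.infinite by fastforce
    then have "\<Union>(E c) \<subseteq> V \<union> X \<union> Q" "finite (V \<union> X \<union> Q)"
      using fin finite_X unfolding V_def by auto
    then have "card (\<Union>(E c)) \<le> card (V \<union> X \<union> Q)" by (simp add: card_mono)
    also have "\<dots> \<le> card V + card X + card Q"
      by (meson add_le_mono1 card_Un_le le_trans)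
    finally show ?thesis .
  qed
  \<comment> \<open>With \<open>n = card C\<close>:
    \<open>3 n + 12 K - 2 (n - 1) - 2 (K - 1) = n + 10 K + 4\<close>.\<close>
  with C1 have "card C + 10 * K + 4 \<le> card V"
    using large[OF c] card_X Q k by linarith
  then have "card C + 10 * K + 4 \<le> card (h ` V)" using inj by (simp add: card_image)
  moreover have "{x, inv_into V h x} \<in> E c \<and> inv_into V h x \<notin> X \<union> Q" if "x \<in> h ` V" for x
    using that inj h by (auto simp: inv_into_f_f) (auto simp: V_def)
  ultimately show thesis
    using hX by (intro that[of "h ` V" "inv_into V h"]) (auto simp: inj_on_inv_into)
qed

text \<open>As \<open>a\<close> and \<open>b\<close> differ, one of the edges \<open>{x, a}\<close>,
  \<open>{y, b}\<close> avoids the given \<open>p\<close>; assigning it to \<open>c\<close> frees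
  \<open>d\<close>.\<close>

lemma reach_step:
  assumes r: "reach P Q c" and d: "d \<in> C - P" and xy: "x \<in> f d" "y \<in> f d"
    and ab: "{x, a} \<in> E c" "{y, b} \<in> E c" "a \<noteq> b" "a \<notin> X \<union> Q" "b \<notin> X \<union> Q"
  shows "reach (insert d P) (insert a (insert b Q)) d"
proof -
  have P: "P \<subseteq> C" "c0 \<in> P" "c \<in> P" "finite Q" "Q \<inter> X = {}"
    using r unfolding reach_def by blast+
  have *: "\<exists>g. rainbow E (C - {d}) g \<and> (\<forall>e\<in>C - insert d P. g e = f e) \<and>
       \<Union>(g ` (C - {d})) \<subseteq> X \<union> (insert a (insert b Q) - {p})"
    if z: "z \<in> f d" "{z, v} \<in> E c" "v \<notin> X \<union> Q" "v \<in> {a, b}" "v \<noteq> p" for z v p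
  proof -
    obtain g where g: "rainbow E (C - {c}) g" "\<And>d. d \<in> C - P \<Longrightarrow> g d = f d"
      "\<And>d. d \<in> C \<Longrightarrow> d \<noteq> c \<Longrightarrow> g d \<subseteq> X \<union> (Q - {p})"
      using reachE[OF r, where p = p] by metis
    \<comment> \<open>\<open>z\<close> lies in \<open>g d = f d\<close>, as \<open>d\<close> has not
      been exchanged yet, and \<open>v\<close> is outside \<open>X \<union> Q\<close>.\<close>
    have dis: "g e \<inter> {z, v} = {}" if "e \<in> C - {d} - {c}" for e
    proof -
      have "g e \<inter> g d = {}" using rainbow_disjoint[OF g(1)] that d P by blast
      then show ?thesis using g(2)[OF d] g(3)[of e] that z by blast
    qed
    have "rainbow E (C - {d}) (g(c := {z, v}))"
      by (rule rainbow_update[OF rainbow_subset[OF g(1)] z(2) dis]) blast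
    moreover have "\<forall>e\<in>C - insert d P. (g(c := {z, v})) e = f e" using g(2) P(3) by auto
    moreover have "(g(c := {z, v})) e \<subseteq> X \<union> (insert a (insert b Q) - {p})" if "e \<in> C - {d}" for e
    proof (cases "e = c")
      case True
      have "z \<in> X" using z d P unfolding X_def by blast
      then show ?thesis using z True by simp
    next
      case False
      then show ?thesis using g(3)[of e] that by auto
    qed
    ultimately show ?thesis by (intro exI[of _ "g(c := {z, v})"]) blast
  qed
  have "\<exists>g. rainbow E (C - {d}) g \<and> (\<forall>e\<in>C - insert d P. g e = f e) \<and>
       \<Union>(g ` (C - {d})) \<subseteq> X \<union> (insert a (insert b Q) - {p})" for p
  proof (cases "p = a")
    case True
    then show ?thesis using ab(3) by (intro *[OF xy(2) ab(2) ab(5)]) auto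
  next
    case False
    then show ?thesis by (intro *[OF xy(1) ab(1) ab(4)]) auto
  qed
  then show ?thesis using P d ab unfolding reach_def by auto
qed

text \<open>Put \<open>b\<close> on \<open>{x, a}\<close>, \<open>c\<close> on \<open>{y, q}\<close>
  and \<open>d\<close> on \<open>{v, s}\<close>: moving \<open>d\<close> frees \<open>x\<close> and
  \<open>y\<close>, moving \<open>c\<close> frees \<open>v\<close>. Only \<open>q\<close> may lie in
  \<open>Q\<close>, so \<open>g\<close> is chosen to avoid it.\<close>

lemma reach_augment:
  assumes r: "reach P Q b" and cd: "c \<in> C - P" "d \<in> C - P" "c \<noteq> d"
    and xy: "x \<in> f d" "y \<in> f d" "x \<noteq> y" and v: "v \<in> f c"
    and e: "{x, a} \<in> E b" "{y, q} \<in> E c" "{v, s} \<in> E d"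
    and out: "a \<notin> X \<union> Q" "q \<notin> X" "s \<notin> X \<union> Q" "q \<noteq> a" "s \<noteq> a" "s \<noteq> q"
  shows False
proof -
  have P: "P \<subseteq> C" "c0 \<in> P" "b \<in> P" using r unfolding reach_def by blast+
  obtain g where g: "rainbow E (C - {b}) g" "\<And>d. d \<in> C - P \<Longrightarrow> g d = f d"
    "\<And>d. d \<in> C \<Longrightarrow> d \<noteq> b \<Longrightarrow> g d \<subseteq> X \<union> (Q - {q})"
    using reachE[OF r, where p = q] by metis
  have X: "x \<in> X" "y \<in> X" "v \<in> X" using xy v cd P unfolding X_def by blast+
  have "f c \<inter> f d = {}" using rainbow_disjoint[OF f, of c d] cd P by blast
  then have v': "v \<noteq> x" "v \<noteq> y" using v xy by blast+
  have dis: "g i \<inter> {x, y, v, a, q, s} = {}" if "i \<in> C - {b, c, d}" for i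
  proof -
    have "g i \<inter> g c = {}" "g i \<inter> g d = {}"
      using rainbow_disjoint[OF g(1)] that cd P by blast+
    then have "g i \<inter> {x, y, v} = {}" using g(2) cd xy v by auto
    moreover have "g i \<inter> {a, q, s} = {}" using g(3)[of i] that out by blast
    ultimately show ?thesis by blast
  qed
  have 1: "rainbow E (C - {d} - {c}) (g(b := {x, a}))"
    by (rule rainbow_update[OF rainbow_subset[OF g(1)] e(1)]) (use dis in blast)+
  have 2: "rainbow E (C - {d}) (g(b := {x, a}, c := {y, q}))"
    by (rule rainbow_update[OF 1 e(2)]) (use dis X out xy in auto)
  have "rainbow E C (g(b := {x, a}, c := {y, q}, d := {v, s}))"
    by (rule rainbow_update[OF 2 e(3)]) (use dis X out xy v' in auto)
  then show False using no_full by blast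
qed

section \<open>Search levels and double counting\<close>

text \<open>Each exchange adds one colour to \<open>P\<close> and two vertices to \<open>Q\<close>;
  the extra one in \<open>k + 1\<close> accounts for \<open>c0\<close>.\<close>

definition R :: "nat \<Rightarrow> 'c set" where
  "R k = {c \<in> C. \<exists>P Q. reach P Q c \<and> card P \<le> k + 1 \<and> card Q \<le> 2 * k}"

lemma R_subset: "R k \<subseteq> C"
  unfolding R_def by blast

lemma finite_R: "finite (R k)"
  using finite_subset[OF R_subset finite_C] .

lemma c0_R: "c0 \<in> R k"
  unfolding R_def using c0 reach_c0 by force

lemma R_Suc: "R k \<subseteq> R (Suc k)"
  unfolding R_def by fastforce

lemma card_R_pos: "1 \<le> card (R k)"
  using c0_R[of k] finite_R[of k] by (metis One_nat_def Suc_leI card_gt_0_iff empty_iff)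

text \<open>Gaining at least \<open>K + 2\<close> colours in each of \<open>K\<close> steps would
  make \<open>R K\<close> larger than \<open>C\<close>.\<close>

lemma obtain_level:
  obtains k where "k < K" "card (R (Suc k)) \<le> card (R k) + K + 1"
proof -
  have "\<exists>k<K. card (R (Suc k)) \<le> card (R k) + K + 1"
  proof (rule ccontr)
    assume a: "\<not> ?thesis"
    have "1 + j * (K + 2) \<le> card (R j)" if "j \<le> K" for j
      using that
    proof (induction j)
      case 0
      show ?case using card_R_pos[of 0] by simp
    next
      case (Suc j)
      then have "1 + j * (K + 2) \<le> card (R j)" "\<not> card (R (Suc j)) \<le> card (R j) + K + 1"
        using a by (simp_all add: Suc_le_eq)
      then show ?case by simp
    qed
    from this[of K] have "1 + K * (K + 2) \<le> card C"
      using card_mono[OF finite_C R_subset] order_trans by blast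
    then show False using K by (simp add: algebra_simps)
  qed
  then show thesis using that by blast
qed

lemma obtain_dense:
  obtains d P Q S h T where
    "d \<in> C - {c0}" "T \<subseteq> C - {c0}" "7 * K + 5 \<le> card T"
    "\<forall>c\<in>insert d T. reach (P c) (Q c) c \<and> card (P c) \<le> K \<and> card (Q c) + 2 \<le> 2 * K"
    "\<forall>c\<in>insert d T. inj_on (h c) (S c) \<and> (\<forall>x\<in>S c. {x, h c x} \<in> E c \<and> h c x \<notin> X \<union> Q c)"
    "\<forall>c\<in>T. d \<notin> P c \<and> f d \<subseteq> S c \<and> f c \<inter> S d \<noteq> {}"
proof -
  obtain k where k: "k < K" "card (R (Suc k)) \<le> card (R k) + K + 1"
    by (rule obtain_level)
  define D where "D = R k"
  have fin: "finite D" "finite (R (Suc k))" using finite_R unfolding D_def by blast+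
  have DC: "D \<subseteq> C" "D \<subseteq> R (Suc k)" using R_subset R_Suc unfolding D_def by blast+
  have "\<forall>c\<in>D. \<exists>P Q S h. reach P Q c \<and> card P \<le> k + 1 \<and> card Q \<le> 2 * k \<and>
      S \<subseteq> X \<and> inj_on h S \<and> (\<forall>x\<in>S. {x, h x} \<in> E c \<and> h x \<notin> X \<union> Q) \<and>
      card C + 10 * K + 4 \<le> card S"
  proof
    fix c assume "c \<in> D"
    then obtain P Q where PQ: "c \<in> C" "reach P Q c" "card P \<le> k + 1" "card Q \<le> 2 * k"
      unfolding D_def R_def by blast
    obtain S h where "S \<subseteq> X" "inj_on h S" "\<forall>x\<in>S. {x, h x} \<in> E c \<and> h x \<notin> X \<union> Q"
      "card C + 10 * K + 4 \<le> card S"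
      by (rule reach_neighbours[OF PQ(2,4) k(1) PQ(1)])
    with PQ show "\<exists>P Q S h. reach P Q c \<and> card P \<le> k + 1 \<and> card Q \<le> 2 * k \<and>
      S \<subseteq> X \<and> inj_on h S \<and> (\<forall>x\<in>S. {x, h x} \<in> E c \<and> h x \<notin> X \<union> Q) \<and>
      card C + 10 * K + 4 \<le> card S"
      by (intro exI[of _ P] exI[of _ Q] exI[of _ S] exI[of _ h]) blast
  qed
  then obtain P Q S h where *: "\<And>c. c \<in> D \<Longrightarrow> reach (P c) (Q c) c \<and> card (P c) \<le> k + 1 \<and>
      card (Q c) \<le> 2 * k \<and> S c \<subseteq> X \<and> inj_on (h c) (S c) \<and>
      (\<forall>x\<in>S c. {x, h c x} \<in> E c \<and> h c x \<notin> X \<union> Q c) \<and> card C + 10 * K + 4 \<le> card (S c)"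
    by metis
  \<comment> \<open>Matching edges \<open>f d\<close> already exchanged on the way to \<open>c\<close> get weight zero, since \<open>c\<close> cannot use them.\<close>
  define w where "w c d = (if d = c0 \<or> d \<in> P c then 0 else card (f d \<inter> S c))" for c d
  have meet: "card (f d \<inter> A) \<le> 2" if "d \<in> C - {c0}" for d A
    using card_mono[OF finite_f[OF that], of "f d \<inter> A"] card_f[OF that] by auto
  have w2: "w c d \<le> 2" if "d \<in> C" for c d
    using meet that unfolding w_def by auto
  have full: "f d \<subseteq> A" if "d \<in> C - {c0}" "card (f d \<inter> A) = 2" for d A
    using card_subset_eq[OF finite_f[OF that(1)], of "f d \<inter> A"] card_f[OF that(1)] that(2)
    by auto
  \<comment> \<open>Outside \<open>D\<close>, at most two edges go to each of the at most
    \<open>k\<close> exchanged colours, two to each of the at most \<open>K + 1\<close> new colours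
    of \<open>R (Suc k)\<close>, and one to each remaining colour. With \<open>k < K\<close>, the
    rest of the \<open>card C + 10 * K + 4\<close> edges gives the bound.\<close>
  have out: "card D + 7 * K + 5 \<le> (\<Sum>d\<in>D. w c d)" if c: "c \<in> D" for c
  proof -
    note * = *[OF c]
    have P: "P c \<subseteq> C" "c0 \<in> P c" using * unfolding reach_def by blast+
    then have finP: "finite (P c)" using finite_C finite_subset by blast
    \<comment> \<open>Otherwise \<open>reach_step\<close> would put \<open>d\<close> into
      \<open>R (Suc k)\<close>.\<close>
    have one: "card (f d \<inter> S c) \<le> 1" if d: "d \<in> C - R (Suc k) - P c" for d
    proof (rule ccontr)
      assume "\<not> ?thesis"
      moreover have d': "d \<in> C - {c0}" using d P by blast
      ultimately have "f d \<subseteq> S c" using meet[OF d', of "S c"] full[OF d', of "S c"] by linarith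
      moreover obtain x y where xy: "f d = {x, y}" "x \<noteq> y"
        using card_f[OF d'] card_2_iff by metis
      ultimately have xyS: "x \<in> S c" "y \<in> S c" by auto
      then have ne: "h c x \<noteq> h c y" using * xy by (meson inj_onD)
      have "reach (insert d (P c)) (insert (h c x) (insert (h c y) (Q c))) d"
        by (rule reach_step[where c = c and x = x and y = y]) (use * d xy xyS ne in auto)
      moreover have "card (insert d (P c)) \<le> Suc k + 1"
        using * card_insert_le_m1 finP by (simp add: card_insert_if)
      moreover have "card (insert (h c x) (insert (h c y) (Q c))) \<le> 2 * Suc k"
        using * by (metis (no_types, lifting) Suc_le_mono card_insert_le_m1 diff_Suc_1 le_trans
          mult_Suc_right numeral_2_eq_2 add_2_eq_Suc zero_less_Suc)
      ultimately show False using d unfolding R_def by blast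
    qed
    have "S c = (\<Union>d\<in>C - {c0}. f d \<inter> S c)" using * unfolding X_def by blast
    then have "card (S c) = card (\<Union>d\<in>C - {c0}. f d \<inter> S c)" by simp
    also have "\<dots> \<le> (\<Sum>d\<in>C - {c0}. card (f d \<inter> S c))"
      using finite_C by (intro card_UN_le) auto
    also have "\<dots> \<le> (\<Sum>d\<in>C - {c0}. (if d \<in> D then w c d else 0) + (if d \<in> P c - {c0} then 2 else 0)
        + (if d \<in> R (Suc k) - D then 2 else 0) + (if d \<in> C - R (Suc k) then 1 else 0))"
    proof (rule sum_mono)
      fix d assume d: "d \<in> C - {c0}"
      show "card (f d \<inter> S c) \<le> (if d \<in> D then w c d else 0) + (if d \<in> P c - {c0} then 2 else 0)
        + (if d \<in> R (Suc k) - D then 2 else 0) + (if d \<in> C - R (Suc k) then 1 else 0)"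
        using meet[OF d, of "S c"] one[of d] d unfolding w_def by auto
    qed
    also have "\<dots> \<le> (\<Sum>d\<in>C. (if d \<in> D then w c d else 0) + (if d \<in> P c - {c0} then 2 else 0)
        + (if d \<in> R (Suc k) - D then 2 else 0) + (if d \<in> C - R (Suc k) then 1 else 0))"
      using finite_C by (intro sum_mono2) auto
    also have "\<dots> = (\<Sum>d\<in>D. w c d) + 2 * card (P c - {c0}) + 2 * card (R (Suc k) - D)
        + card (C - R (Suc k))"
    proof -
      have restrict: "(\<Sum>d\<in>C. if d \<in> A then a d else 0) = sum a A" if "A \<subseteq> C" for A and a :: "'c \<Rightarrow> nat"
        using sum.inter_restrict[OF finite_C, of a A] that by (simp add: inf_absorb2)
      have "D \<subseteq> C" "P c - {c0} \<subseteq> C" "R (Suc k) - D \<subseteq> C" "C - R (Suc k) \<subseteq> C"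
        using DC P R_subset by blast+
      then show ?thesis
        by (simp only: sum.distrib restrict sum_constant) simp
    qed
    also have "card (P c - {c0}) \<le> k"
    proof -
      have "card (P c) \<le> k + 1" using * by blast
      then show ?thesis using P(2) finP by simp
    qed
    also have "card (R (Suc k) - D) = card (R (Suc k)) - card D"
      using DC fin by (simp add: card_Diff_subset)
    also have "card (C - R (Suc k)) = card C - card (R (Suc k))"
      using R_subset fin by (simp add: card_Diff_subset)
    finally have "card (S c) \<le> (\<Sum>d\<in>D. w c d) + 2 * k + 2 * (card (R (Suc k)) - card D)
        + (card C - card (R (Suc k)))" by simp
    moreover have "card D \<le> card (R (Suc k))" "card (R (Suc k)) \<le> card C"
      using card_mono[OF fin(2) DC(2)] card_mono[OF finite_C R_subset] by blast+
    moreover have "card C + 10 * K + 4 \<le> card (S c)" using * by blast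
    ultimately show ?thesis using k unfolding D_def by linarith
  qed
  define T where "T d = {c \<in> D. w c d = 2 \<and> 1 \<le> w d c}" for d
  have finT: "finite (T d)" for d unfolding T_def using fin by simp
  have "\<exists>d\<in>D. 7 * K + 5 \<le> card (T d)"
  proof (rule ccontr)
    assume "\<not> ?thesis"
    then have small: "card (T d) \<le> 7 * K + 4" if "d \<in> D" for d using that by fastforce
    define t :: "'c \<Rightarrow> 'c \<Rightarrow> nat" where "t d c = (if c \<in> T d then 1 else 0)" for d c
    have ts: "(\<Sum>c\<in>D. t d c) = card (T d)" for d
    proof -
      have "D \<inter> T d = T d" unfolding T_def by blast
      then show ?thesis using fin unfolding t_def by (simp flip: sum.inter_restrict)
    qed
    have swap: "(\<Sum>d\<in>D. \<Sum>c\<in>D. a d c) = (\<Sum>d\<in>D. \<Sum>c\<in>D. a c d)" for a :: "'c \<Rightarrow> 'c \<Rightarrow> nat"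
      by (rule sum.swap)
    have "2 * (card D * (card D + 7 * K + 5)) = 2 * (\<Sum>c\<in>D. card D + 7 * K + 5)" by simp
    also have "\<dots> \<le> 2 * (\<Sum>c\<in>D. \<Sum>d\<in>D. w c d)"
      using out by (intro mult_le_mono2 sum_mono)
    also have "\<dots> = (\<Sum>c\<in>D. \<Sum>d\<in>D. w c d + w d c)"
      using swap[of w] by (simp add: sum.distrib)
    \<comment> \<open>A sum above 2 forces one weight to be 2 and the other positive, which
      \<open>t\<close> records; the sum 4 is recorded in both orders.\<close>
    also have "\<dots> \<le> (\<Sum>c\<in>D. \<Sum>d\<in>D. 2 + t d c + t c d)"
    proof (intro sum_mono)
      fix c d assume cd: "c \<in> D" "d \<in> D"
      then have "w c d \<le> 2" "w d c \<le> 2" using w2 DC by blast+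
      then have "w c d \<in> {0, 1, 2}" "w d c \<in> {0, 1, 2}" by auto
      then show "w c d + w d c \<le> 2 + t d c + t c d"
        using cd unfolding t_def T_def by auto
    qed
    also have "\<dots> = 2 * (card D * card D) + 2 * (\<Sum>d\<in>D. card (T d))"
      using swap[of t] ts unfolding sum.distrib by simp
    also have "\<dots> \<le> 2 * (card D * card D) + 2 * (card D * (7 * K + 4))"
      using sum_bounded_above[of D "\<lambda>d. card (T d)" "7 * K + 4"] small by simp
    finally have "card D * (card D + 7 * K + 5) \<le> card D * (card D + 7 * K + 4)"
      by (simp add: algebra_simps)
    then show False using card_R_pos[of k] unfolding D_def by simp
  qed
  then obtain d where d: "d \<in> D" "7 * K + 5 \<le> card (T d)" by blast
  have T_D: "d \<in> C - {c0}" "c \<in> C - {c0}" "d \<notin> P c" "f d \<subseteq> S c" "f c \<inter> S d \<noteq> {}"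
    if "c \<in> T d" for c
  proof -
    have "w c d = 2" "w d c \<noteq> 0" "c \<in> D" using that unfolding T_def by auto
    then show "d \<in> C - {c0}" "c \<in> C - {c0}" "d \<notin> P c" "f d \<subseteq> S c" "f c \<inter> S d \<noteq> {}"
      using d DC full[of d "S c"] unfolding w_def by (auto split: if_splits)
  qed
  \<comment> \<open>Nonemptiness rules out \<open>d = c0\<close>, where all weights
    \<open>w c d\<close> vanish.\<close>
  have "T d \<noteq> {}" using d by auto
  then have dC: "d \<in> C - {c0}" using T_D by blast
  have TD: "insert d (T d) \<subseteq> D" using d unfolding T_def by blast
  show thesis
  proof (rule that[of d "T d" P Q h S])
    show "\<forall>c\<in>insert d (T d). reach (P c) (Q c) c \<and> card (P c) \<le> K \<and> card (Q c) + 2 \<le> 2 * K"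
      using * TD k by force
    show "\<forall>c\<in>insert d (T d). inj_on (h c) (S c) \<and>
        (\<forall>x\<in>S c. {x, h c x} \<in> E c \<and> h c x \<notin> X \<union> Q c)"
      using * TD by blast
  qed (use dC d T_D in blast)+
qed

section \<open>Completing the matching\<close>

lemma contradiction: False
proof -
  obtain d P Q S h T where d: "d \<in> C - {c0}" and T: "T \<subseteq> C - {c0}" "7 * K + 5 \<le> card T"
    and 1: "\<forall>c\<in>insert d T. reach (P c) (Q c) c \<and> card (P c) \<le> K \<and> card (Q c) + 2 \<le> 2 * K"
    and 2: "\<forall>c\<in>insert d T. inj_on (h c) (S c) \<and>
        (\<forall>x\<in>S c. {x, h c x} \<in> E c \<and> h c x \<notin> X \<union> Q c)"
    and 3: "\<forall>c\<in>T. d \<notin> P c \<and> f d \<subseteq> S c \<and> f c \<inter> S d \<noteq> {}"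
    by (rule obtain_dense)
  have r: "reach (P c) (Q c) c" and P: "card (P c) \<le> K" and Q: "card (Q c) + 2 \<le> 2 * K"
    and inj: "inj_on (h c) (S c)" if "c \<in> insert d T" for c
    using 1 2 that by blast+
  have h: "{x, h c x} \<in> E c \<and> h c x \<notin> X \<union> Q c" if "c \<in> insert d T" "x \<in> S c" for c x
    using 2 that by blast
  have dT: "d \<notin> P c \<and> f d \<subseteq> S c \<and> f c \<inter> S d \<noteq> {}" if "c \<in> T" for c
    using 3 that by blast
  obtain x y where xy: "f d = {x, y}" "x \<noteq> y" using card_f[OF d] card_2_iff by metis
  have finT: "finite T" using T finite_C finite_subset by blast
  define a where "a c = h c x" for c
  define b where "b c = h c y" for c
  have ab: "{x, a c} \<in> E c" "{y, b c} \<in> E c" "a c \<notin> X \<union> Q c" "b c \<notin> X \<union> Q c" "a c \<noteq> b c"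
    if "c \<in> T" for c
    using h[of c] dT[OF that] that xy inj_onD[OF inj[of c], of x y] unfolding a_def b_def by auto
  have "\<forall>c\<in>T. \<exists>z. z \<in> f c \<inter> S d" using dT by blast
  then obtain z where z: "\<And>c. c \<in> T \<Longrightarrow> z c \<in> f c \<inter> S d" by metis
  define s where "s c = h d (z c)" for c
  have s: "{z c, s c} \<in> E d" "s c \<notin> X" if "c \<in> T" for c
    using h[of d "z c"] z[OF that] unfolding s_def by auto
  have s_inj: "inj_on s T"
  proof (rule inj_onI, rule ccontr)
    fix i j assume ij: "i \<in> T" "j \<in> T" "s i = s j" "i \<noteq> j"
    then have "z i = z j" using inj_onD[OF inj[of d], of "z i" "z j"] z unfolding s_def by blast
    moreover have "f i \<inter> f j = {}" using rainbow_disjoint[OF f, of i j] ij T by blast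
    ultimately show False using z[of i] z[of j] ij by auto
  qed
  \<comment> \<open>Outside \<open>bad c\<close>, only the end points \<open>a\<close>, \<open>b\<close> at \<open>f d\<close> can obstruct completing the matching via \<open>c\<close>;
    three colours cannot obstruct each other pairwise.\<close>
  define bad where "bad c = P c \<union> {i \<in> T. s i \<in> Q c \<union> {a c, b c}}" for c
  \<comment> \<open>\<open>P c\<close> has at most \<open>K\<close> elements; since \<open>s\<close>
    is injective, the other set has at most \<open>card (Q c) + 2 \<le> 2 * K\<close>.\<close>
  have bad: "card (bad c) \<le> 3 * K" "finite (bad c)" "c \<in> bad c" if c: "c \<in> T" for c
  proof -
    have fin: "finite (Q c)" "finite (P c)" "c \<in> P c"
      using r[of c] c finite_subset[OF _ finite_C, of "P c"] unfolding reach_def by blast+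
    have "card {i \<in> T. s i \<in> Q c \<union> {a c, b c}} \<le> card (Q c \<union> {a c, b c})"
    proof (rule card_inj_on_le)
      show "inj_on s {i \<in> T. s i \<in> Q c \<union> {a c, b c}}"
        by (rule inj_on_subset[OF s_inj]) blast
    qed (use fin in auto)
    also have "\<dots> \<le> card (Q c) + card {a c, b c}" by (rule card_Un_le)
    also have "\<dots> \<le> 2 * K" using Q[of c] c card_insert_le_m1[of 2 "{b c}" "a c"] by simp
    finally show "card (bad c) \<le> 3 * K"
      using card_Un_le[of "P c" "{i \<in> T. s i \<in> Q c \<union> {a c, b c}}"] P[of c] c
      unfolding bad_def by fastforce
    show "finite (bad c)" "c \<in> bad c" using fin finT unfolding bad_def by auto
  qed
  \<comment> \<open>If a disjunction failed, \<open>reach_augment\<close> would apply with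
    \<open>i\<close> at one end of \<open>f d\<close>, \<open>j\<close> at the other and
    \<open>d\<close> on \<open>{z j, s j}\<close>. The two disjunctions are the two
    orientations.\<close>
  have cross: "(b j = a i \<or> b j = s j) \<and> (a j = b i \<or> a j = s j) \<and> s j \<noteq> a i \<and> s j \<noteq> b i"
    if i: "i \<in> T" and j: "j \<in> T - bad i" for i j
  proof -
    have ij: "reach (P i) (Q i) i" "j \<in> C - P i" "d \<in> C - P i" "s j \<notin> X \<union> Q i"
      "s j \<noteq> a i" "s j \<noteq> b i" "z j \<in> f j" "{z j, s j} \<in> E d"
      using r[of i] i j T(1) d dT[of i] s[of j] z[of j] unfolding bad_def by blast+
    have "j \<noteq> d" using dT[of j] r[of j] j unfolding reach_def by blast
    have fd: "x \<in> f d" "y \<in> f d" using xy by blast+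
    have "b j = a i \<or> b j = s j"
      using reach_augment[OF ij(1,2,3) \<open>j \<noteq> d\<close> _ _ xy(2) ij(7) ab(1)[OF i] ab(2)[of j] ij(8)]
        ab[OF i] ab[of j] ij(4,5) j fd by (metis DiffD1 UnCI)
    moreover have "a j = b i \<or> a j = s j"
      using reach_augment[OF ij(1,2,3) \<open>j \<noteq> d\<close> _ _ xy(2)[symmetric] ij(7) ab(2)[OF i] ab(1)[of j] ij(8)]
        ab[OF i] ab[of j] ij(4,6) j fd by (metis DiffD1 UnCI)
    ultimately show ?thesis using ij by blast
  qed
  \<comment> \<open>Two sets \<open>bad c\<close> together have at most
    \<open>6 * K < 7 * K + 5\<close> elements.\<close>
  have avoid: "\<exists>j\<in>T. j \<notin> B" if "card B \<le> 6 * K" "finite B" for B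
    using that T(2) card_mono[of B T] by fastforce
  obtain c1 where c1: "c1 \<in> T" using avoid[of "{}"] by auto
  obtain c2 where c2: "c2 \<in> T - bad c1" using avoid[of "bad c1"] bad[OF c1] by auto
  then have "card (bad c1 \<union> bad c2) \<le> 6 * K" "finite (bad c1 \<union> bad c2)"
    using bad[OF c1] bad[of c2] card_Un_le[of "bad c1" "bad c2"] by auto
  then obtain c3 where c3: "c3 \<in> T - bad c1" "c3 \<in> T - bad c2" using avoid by blast
  \<comment> \<open>One of \<open>a c3\<close>, \<open>b c3\<close> differs from
    \<open>s c3\<close>. If it is \<open>b c3\<close>, then \<open>b c3 = a c1 = a c2\<close>; but
    \<open>a c2\<close> is \<open>b c1\<close> or \<open>s c2\<close>, neither equal to
    \<open>a c1\<close>. The other case is symmetric.\<close>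
  show False
    using cross[OF c1 c2] cross[OF c1 c3(1)] cross[of c2 c3] c2 c3 ab(5)[OF c1] ab(5)[of c2] ab(5)[of c3]
    by auto
qed

end

section \<open>Induction on the set of colours\<close>

context clique_colouring
begin

text \<open>\<open>N\<close> stays fixed while \<open>C\<close> grows, so the size hypothesis passes
  to smaller colour sets. The step refutes \<open>blocked\<close> with \<open>K\<close> the integer
  part of the square root.\<close>

lemma rainbow_exists:
  fixes C :: "'c set" and N :: nat
  assumes "finite C" "card C \<le> N"
    and large: "\<And>c. c \<in> C \<Longrightarrow> 3 * real N + 12 * sqrt N \<le> real (card (\<Union>(E c)))"
  shows "\<exists>f. rainbow E C f"
  using assms
proof (induction C rule: finite_induct)
  case empty
  then show ?case unfolding rainbow_def disjoint_family_on_def by simp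
next
  case (insert c C)
  then obtain f where f: "rainbow E C f" by auto
  let ?n = "card (insert c C)" and ?K = "nat \<lfloor>sqrt (card (insert c C))\<rfloor>"
  have "real ?K = of_int \<lfloor>sqrt ?n\<rfloor>" by simp
  then have K: "real ?K \<le> sqrt ?n" "sqrt ?n < real ?K + 1" by linarith+
  show ?case
  proof (rule ccontr)
    assume a: "\<not> ?thesis"
    have "real ?n < (real ?K + 1)\<^sup>2"
      using K(2) real_sqrt_less_iff[of "real ?n" "(real ?K + 1)\<^sup>2"] by simp
    also have "\<dots> = real ((?K + 1)\<^sup>2)" by simp
    finally have n: "?n < (?K + 1)\<^sup>2" by (simp only: of_nat_less_iff)
    have le: "3 * ?n + 12 * ?K \<le> card (\<Union>(E i))" if "i \<in> insert c C" for i
    proof -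
      have "real ?n \<le> real N" using insert.prems(1) by simp
      moreover from this have "sqrt ?n \<le> sqrt N" by simp
      ultimately have "3 * real ?n + 12 * real ?K \<le> 3 * real N + 12 * sqrt N" using K by linarith
      then have "real (3 * ?n + 12 * ?K) \<le> 3 * real N + 12 * sqrt N"
        by (simp only: of_nat_add of_nat_mult of_nat_numeral)
      also have "\<dots> \<le> real (card (\<Union>(E i)))" using insert.prems(2) that by blast
      finally show ?thesis by (simp only: of_nat_le_iff)
    qed
    interpret blocked E "insert c C" c f ?K
      by unfold_locales
        (use insert.hyps f a n le in \<open>auto simp: power2_eq_square simp del: card_insert_disjoint\<close>)
    show False by (rule contradiction)
  qed
qed

end

section \<open>Passage from multigraphs to vertex pairs and back\<close>

definition colour_edges :: "('v, 'e) multigraph \<Rightarrow> ('e \<Rightarrow> 'c) \<Rightarrow> 'c \<Rightarrow> 'v set set" where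
  "colour_edges G col c = ends G ` {e \<in> edges G. col e = c}"

text \<open>Both edges contain \<open>v\<close>, so they lie in the same part, which is
  complete.\<close>

lemma clique_union_trans:
  assumes "disjoint_union_of_nontrivial_cliques H"
    and "e \<in> edges H" "ends H e = {u, v}" "e' \<in> edges H" "ends H e' = {v, w}" "u \<noteq> w"
  obtains e'' where "e'' \<in> edges H" "ends H e'' = {u, w}"
proof -
  obtain B where B: "partition_on (verts H) B" "\<And>A. A \<in> B \<Longrightarrow> nontrivial_clique (induced H A)"
    "\<And>e. e \<in> edges H \<Longrightarrow> \<exists>A\<in>B. ends H e \<subseteq> A"
    using assms(1) unfolding disjoint_union_of_nontrivial_cliques_def by blast
  obtain A A' where A: "A \<in> B" "{u, v} \<subseteq> A" "A' \<in> B" "{v, w} \<subseteq> A'"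
    using B(3) assms by metis
  then have "A = A'" using partition_onD2[OF B(1)] unfolding disjoint_def by blast
  then show thesis
    using A B(2)[of A] assms(6) that
    unfolding nontrivial_clique_def complete_graph_def induced_def by force
qed

theorem theorem1p3:
  fixes \<delta> :: real and n :: nat
    and G :: "('v, 'e) multigraph" and col :: "'e \<Rightarrow> 'c" and C :: "'c set"
  assumes "\<delta> > 0"
    and "real n \<ge> 144 / \<delta>\<^sup>2"
    and "is_multigraph G"
    and "edge_colouring G col C" and "card C = n"
    and "\<forall>c\<in>C. real (card (verts (colour_subgraph G col c))) \<ge> (3 + \<delta>) * real n
             \<and> disjoint_union_of_nontrivial_cliques (colour_subgraph G col c)"
  shows "\<exists>M. rainbow_matching G col M \<and> card M = n"
proof -
  \<comment> \<open>Off \<open>C\<close> nothing is known about cliques, so \<open>E\<close> is made empty there.\<close>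
  define E where "E c = (if c \<in> C then colour_edges G col c else {})" for c
  interpret clique_colouring E
  proof
    fix e c assume "e \<in> E c"
    then show "card e = 2"
      using assms(3) unfolding E_def colour_edges_def is_multigraph_def by (auto split: if_splits)
  next
    fix u v w c assume uv: "{u, v} \<in> E c" "{v, w} \<in> E c" "u \<noteq> w"
    then have c: "c \<in> C" unfolding E_def by (auto split: if_splits)
    obtain e e' where "e \<in> edges (colour_subgraph G col c)" "ends G e = {u, v}"
      "e' \<in> edges (colour_subgraph G col c)" "ends G e' = {v, w}"
      using uv c unfolding E_def colour_edges_def colour_subgraph_def by auto
    moreover have "ends (colour_subgraph G col c) = ends G" unfolding colour_subgraph_def by simp
    ultimately obtain e'' where "e'' \<in> edges (colour_subgraph G col c)" "ends G e'' = {u, w}"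
      using clique_union_trans[of "colour_subgraph G col c" e u v e' w] c assms(6) uv(3) by metis
    then show "{u, w} \<in> E c"
      using c unfolding E_def colour_edges_def colour_subgraph_def by auto
  qed
  \<comment> \<open>The threshold \<open>144 / \<delta>\<^sup>2\<close> is what makes
    \<open>12 * sqrt n \<le> \<delta> * n\<close>.\<close>
  have "12\<^sup>2 \<le> real n * \<delta>\<^sup>2" using assms(1,2) by (simp add: field_simps)
  then have "12 \<le> sqrt (real n * \<delta>\<^sup>2)" using real_le_rsqrt by blast
  then have "12 \<le> \<delta> * sqrt n" using assms(1) by (simp add: real_sqrt_mult mult.commute)
  then have "12 * sqrt n \<le> \<delta> * sqrt n * sqrt n" by (intro mult_right_mono) auto
  then have "3 * real n + 12 * sqrt n \<le> (3 + \<delta>) * real n" by (simp add: algebra_simps)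
  moreover have "\<Union>(E c) = verts (colour_subgraph G col c)" if "c \<in> C" for c
    using that unfolding E_def colour_edges_def colour_subgraph_def by auto
  ultimately have "3 * real n + 12 * sqrt n \<le> real (card (\<Union>(E c)))" if "c \<in> C" for c
    using that assms(6) by fastforce
  moreover have "finite C" using assms(4) unfolding edge_colouring_def by blast
  ultimately obtain f where f: "rainbow E C f" using rainbow_exists assms(5) by blast
  \<comment> \<open>Each chosen vertex pair is lifted back to an actual edge of its colour.\<close>
  have "\<forall>c\<in>C. \<exists>e. e \<in> edges G \<and> col e = c \<and> ends G e = f c"
    using rainbow_edge[OF f] unfolding E_def colour_edges_def by fastforce
  then obtain g where g: "\<And>c. c \<in> C \<Longrightarrow> g c \<in> edges G \<and> col (g c) = c \<and> ends G (g c) = f c"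
    by metis
  then have "matching G (g ` C)"
    using rainbow_disjoint[OF f] unfolding matching_def by (auto; metis disjoint_iff)
  moreover have "inj_on col (g ` C)" "inj_on g C"
    using g by (auto simp: inj_on_def) (metis g)
  ultimately show ?thesis
    using assms(5) card_image unfolding rainbow_matching_def by blast
qed

end
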